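(* Let $\Sigma$ be a single-input single-output linear discrete-time system $$x_{k+1}=Ax_k+Bu_k,\qquad y_k=Cx_k,$$ with $A\in\mathbb R^{n\times n}$, $B\in\mathbb R^{n\times 1}$, $C\in\mathbb R^{1\times n}$, $x_k\in\mathbb R^n$, $u_k,y_k\in\mathbb R$, and transfer function $G(z)=C(zI-A)^{-1}B$. Suppose that the realization $(A,B,C)$ is minimal, that $\det(I-A)\ne 0$, and that $\Sigma$ is a discrete-time negative imaginary (NI) system. Let $\mathcal H$ be the hybrid integrator-gain system (HIGS) with parameters $\omega_h,k_h\in\mathbb R$, input $e_k\in\mathbb R$, state $\widetilde x_k\in\mathbb R$ and output $\widetilde y_k\in\mathbb R$, $$\mathcal H:\quad \begin{cases}\widetilde x_{k+1}=\widetilde x_k+\omega_h e_k, & \text{if } (\widetilde x_k,e_k)\in\mathcal F,\\ \widetilde x_{k+1}=k_h e_k, & \text{if } (\widetilde x_k,e_k)\notin\mathcal F,\\ \widetilde y_k=\widetilde x_{k+1},\end{cases}$$ where $\mathcal F=\{(x,e)\in\mathbb R^2 : (x+\omega_h e)\,e\ge \tfrac{1}{k_h}(x+\omega_h e)^2\}$, and suppose that $$0<\omega_h\le k_h<\frac{1}{G(1)}.$$ Then the closed-loop positive feedback interconnection of $\Sigma$ and $\mathcal H$ defined by $e_k=y_k$ and $u_k=\widetilde y_k$ for all $k$ is asymptotically stable.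
   Context: A function $V:\mathbb R^n\to\mathbb R$ is positive definite if $V(0)=0$ and $V(x)>0$ for all $x\ne 0$. Discrete-time negative imaginary (NI) system: a system $x_{k+1}=f(x_k,u_k)$, $y_k=h(x_k)$, $k\in\mathbb N$, with $f:\mathbb R^n\times\mathbb R^p\to\mathbb R^n$, $h:\mathbb R^n\to\mathbb R^p$, is NI if there exists a positive definite function $V:\mathbb R^n\to\mathbb R$ such that for arbitrary $x_k$ and $u_k$, $$V(x_{k+1})-V(x_k)\le u_k^T(y_{k+1}-y_k)\quad\text{for all } k,$$ where $y_{k+1}=h(x_{k+1})$. For the linear system in the claim, $p=1$, $f(x,u)=Ax+Bu$ and $h(x)=Cx$. Minimal means that $(A,B)$ is controllable and $(A,C)$ is observable. The closed-loop interconnection is the autonomous discrete-time system with state $(x_k,\widetilde x_k)\in\mathbb R^n\times\mathbb R$: with $e_k=Cx_k$, the state $\widetilde x_{k+1}$ is determined from $(\widetilde x_k,e_k)$ by $\mathcal H$, and $x_{k+1}=Ax_k+B\widetilde x_{k+1}$. Asymptotic stability of the closed loop means asymptotic stability (Lyapunov stability together with convergence of trajectories to the equilibrium) of its equilibrium at the origin $(x,\widetilde x)=(0,0)$. *)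

theory Defs
  imports "HOL-Analysis.Analysis"
begin

subsection \<open>Discrete-time systems\<close>

definition positive_definite :: "(real^'n \<Rightarrow> real) \<Rightarrow> bool" where
  "positive_definite V \<longleftrightarrow> V 0 = 0 \<and> (\<forall>x. x \<noteq> 0 \<longrightarrow> V x > 0)"

text \<open>Since the system is time-invariant and \<open>x\<^sub>k\<close>, \<open>u\<^sub>k\<close> are arbitrary, the dissipation
  inequality for all \<open>k\<close> is the inequality for all states and inputs.\<close>

definition negative_imaginary ::
    "(real^'n \<Rightarrow> real^'p \<Rightarrow> real^'n) \<Rightarrow> (real^'n \<Rightarrow> real^'p) \<Rightarrow> bool" where
  "negative_imaginary f h \<longleftrightarrow>
     (\<exists>V. positive_definite V \<and> (\<forall>x u. V (f x u) - V x \<le> u \<bullet> (h (f x u) - h x)))"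

primrec state_seq :: "('x \<Rightarrow> 'u \<Rightarrow> 'x) \<Rightarrow> 'x \<Rightarrow> (nat \<Rightarrow> 'u) \<Rightarrow> nat \<Rightarrow> 'x" where
  "state_seq f x0 u 0 = x0"
| "state_seq f x0 u (Suc k) = f (state_seq f x0 u k) (u k)"

subsection \<open>Linear systems\<close>

text \<open>A matrix with \<open>m\<close> rows and \<open>n\<close> columns has type \<open>real^'n^'m\<close>.\<close>

definition lin_step :: "real^'n^'n \<Rightarrow> real^'p^'n \<Rightarrow> real^'n \<Rightarrow> real^'p \<Rightarrow> real^'n" where
  "lin_step A B x u = A *v x + B *v u"

definition lin_output :: "real^'n^'q \<Rightarrow> real^'n \<Rightarrow> real^'q" where
  "lin_output C x = C *v x"

text \<open>Controllability: every state can be steered to every state in finitely many steps.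
  Observability: the output sequence of the unforced system determines the initial state.\<close>

definition controllable :: "real^'n^'n \<Rightarrow> real^'p^'n \<Rightarrow> bool" where
  "controllable A B \<longleftrightarrow> (\<forall>x0 x1. \<exists>u N. state_seq (lin_step A B) x0 u N = x1)"

definition observable :: "real^'n^'n \<Rightarrow> real^'n^'q \<Rightarrow> bool" where
  "observable A C \<longleftrightarrow>
     (\<forall>x0 x0'. (\<forall>k. lin_output C (((*v) A ^^ k) x0) = lin_output C (((*v) A ^^ k) x0'))
        \<longrightarrow> x0 = x0')"

definition minimal_realization :: "real^'n^'n \<Rightarrow> real^'p^'n \<Rightarrow> real^'n^'q \<Rightarrow> bool" where
  "minimal_realization A B C \<longleftrightarrow> controllable A B \<and> observable A C"

text \<open>\<open>mat z\<close> is \<open>z I\<close>; the value is meaningful when \<open>z I - A\<close> is invertible.\<close>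

definition transfer_function ::
    "'a::field^'n^'n \<Rightarrow> 'a^'p^'n \<Rightarrow> 'a^'n^'q \<Rightarrow> 'a \<Rightarrow> 'a^'p^'q" where
  "transfer_function A B C z = C ** matrix_inv (mat z - A) ** B"

subsection \<open>The hybrid integrator-gain system\<close>

definition higs_region :: "real \<Rightarrow> real \<Rightarrow> (real \<times> real) set" where
  "higs_region \<omega> \<kappa> = {(x, e). (x + \<omega> * e) * e \<ge> 1 / \<kappa> * (x + \<omega> * e)\<^sup>2}"

definition higs_step :: "real \<Rightarrow> real \<Rightarrow> real \<Rightarrow> real \<Rightarrow> real" where
  "higs_step \<omega> \<kappa> x e = (if (x, e) \<in> higs_region \<omega> \<kappa> then x + \<omega> * e else \<kappa> * e)"

definition higs_output :: "real \<Rightarrow> real \<Rightarrow> real \<Rightarrow> real \<Rightarrow> real" where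
  "higs_output \<omega> \<kappa> x e = higs_step \<omega> \<kappa> x e"

subsection \<open>Closed loop and asymptotic stability\<close>

text \<open>One step of the positive feedback interconnection \<open>e\<^sub>k = y\<^sub>k\<close>, \<open>u\<^sub>k = \<close> HIGS output, of a
  single-input single-output system \<open>(f, h)\<close> with the HIGS. Signals in \<open>real^1\<close> and \<open>real\<close> are
  identified by \<open>vec\<close> and \<open>$ 1\<close>.\<close>

definition higs_closed_loop ::
    "(real^'n \<Rightarrow> real^1 \<Rightarrow> real^'n) \<Rightarrow> (real^'n \<Rightarrow> real^1) \<Rightarrow> real \<Rightarrow> real
      \<Rightarrow> (real^'n) \<times> real \<Rightarrow> (real^'n) \<times> real" where
  "higs_closed_loop f h \<omega> \<kappa> = (\<lambda>(x, xh).
     let e = h x $ 1; u = vec (higs_output \<omega> \<kappa> xh e)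
     in (f x u, higs_step \<omega> \<kappa> xh e))"

text \<open>Asymptotic stability of the equilibrium \<open>p\<close> of \<open>z\<^sub>k\<^sub>+\<^sub>1 = F z\<^sub>k\<close>: Lyapunov stability together
  with convergence of all trajectories to \<open>p\<close>.\<close>

definition lyapunov_stable :: "('a::metric_space \<Rightarrow> 'a) \<Rightarrow> 'a \<Rightarrow> bool" where
  "lyapunov_stable F p \<longleftrightarrow>
     (\<forall>\<epsilon>>0. \<exists>\<delta>>0. \<forall>z. dist z p < \<delta> \<longrightarrow> (\<forall>k. dist ((F ^^ k) z) p < \<epsilon>))"

definition asymptotically_stable :: "('a::metric_space \<Rightarrow> 'a) \<Rightarrow> 'a \<Rightarrow> bool" where
  "asymptotically_stable F p \<longleftrightarrow>
     F p = p \<and> lyapunov_stable F p \<and> (\<forall>z. (\<lambda>k. (F ^^ k) z) \<longlonglongrightarrow> p)"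

end

theory Submission
  imports Defs
begin

text \<open>The given storage function need not be continuous, so it is replaced by the required supply,
  the least supply over all input sequences steering the origin to a given state. Since the supply
  rate is quadratic, the required supply \<open>S\<close> inherits convexity and the parallelogram law, and it
  dominates the given storage function, hence is positive definite. Comparing \<open>S\<close> with its value at
  the steady state of a constant input \<open>u\<close> gives \<open>S x - u y \<ge> - G(1) u\<^sup>2 / 2\<close>, so
  \<open>S x - u y + u\<^sup>2 / (2 k\<^sub>h)\<close> is a positive definite function of \<open>(x, u)\<close>. It decreases by at least
  \<open>(u\<^sub>k - u\<^sub>k\<^sub>-\<^sub>1)\<^sup>2 / (2 k\<^sub>h)\<close> along the closed loop, which gives stability and
  \<open>u\<^sub>k - u\<^sub>k\<^sub>-\<^sub>1 \<longlonglongrightarrow> 0\<close>. The sector bound then forces \<open>u\<^sub>k - k\<^sub>h y\<^sub>k \<longlonglongrightarrow> 0\<close>, observability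
  forces \<open>x\<^sub>k\<^sub>+\<^sub>1 - x\<^sub>k \<longlonglongrightarrow> 0\<close>, and as \<open>k\<^sub>h G(1) \<noteq> 1\<close> the only possible limit is the origin.\<close>

section \<open>Trajectories from the origin and the supply they consume\<close>

locale linear_siso =
  fixes A :: "'x::euclidean_space \<Rightarrow> 'x" and b c :: 'x
  assumes linear_A: "linear A"
begin

definition step :: "'x \<Rightarrow> real \<Rightarrow> 'x" where
  "step x u = A x + u *\<^sub>R b"

abbreviation reach :: "(nat \<Rightarrow> real) \<Rightarrow> nat \<Rightarrow> 'x" where
  "reach \<equiv> state_seq step 0"

definition total_supply :: "(nat \<Rightarrow> real) \<Rightarrow> nat \<Rightarrow> real" where
  "total_supply u N = (\<Sum>k<N. u k * (c \<bullet> reach u (Suc k) - c \<bullet> reach u k))"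

definition supplies :: "'x \<Rightarrow> real set" where
  "supplies x = {total_supply u N |u N. reach u N = x}"

text \<open>On the reals \<open>Inf\<close> is informative only for a nonempty set bounded below;
  \<open>dissipative_siso\<close> provides the first by reachability and the second by the storage
  function.\<close>

definition required_supply :: "'x \<Rightarrow> real" where
  "required_supply x = Inf (supplies x)"

lemma reach_linear:
  "reach (\<lambda>k. p * u k + q * v k) N = p *\<^sub>R reach u N + q *\<^sub>R reach v N"
  by (induction N)
    (simp_all add: step_def linear_add[OF linear_A] linear_scale[OF linear_A] algebra_simps)

lemma reach_cong: "(\<And>k. k < N \<Longrightarrow> u k = v k) \<Longrightarrow> reach u N = reach v N"
  by (induction N) simp_all

lemma total_supply_cong:
  assumes "\<And>k. k < N \<Longrightarrow> u k = v k"
  shows "total_supply u N = total_supply v N"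
proof -
  have "reach u k = reach v k" if "k \<le> N" for k
    using that assms by (intro reach_cong) simp
  then show ?thesis
    unfolding total_supply_def using assms by (intro sum.cong) (simp_all del: state_seq.simps)
qed

lemma total_supply_linear:
  "total_supply (\<lambda>k. p * u k + q * v k) N = (\<Sum>k<N. (p * u k + q * v k) *
     (p * (c \<bullet> reach u (Suc k) - c \<bullet> reach u k) + q * (c \<bullet> reach v (Suc k) - c \<bullet> reach v k)))"
  unfolding total_supply_def reach_linear
  by (simp add: inner_add_right algebra_simps del: state_seq.simps)

lemma total_supply_scale: "total_supply (\<lambda>k. p * u k) N = p\<^sup>2 * total_supply u N"
  using total_supply_linear[of p u 0 u N]
  by (simp add: total_supply_def sum_distrib_left power2_eq_square algebra_simps del: state_seq.simps)

text \<open>The trivial coefficients are kept for rewriting with \<open>total_supply_linear\<close> and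
  \<open>reach_linear\<close>.\<close>

lemma total_supply_parallelogram:
  "total_supply (\<lambda>k. 1 * u k + 1 * v k) N + total_supply (\<lambda>k. 1 * u k + (-1) * v k) N
    = 2 * total_supply u N + 2 * total_supply v N"
  unfolding total_supply_linear unfolding total_supply_def sum_distrib_left sum.distrib[symmetric]
  by (intro sum.cong refl) algebra

lemma total_supply_convex_combination:
  "total_supply (\<lambda>k. (1 - t) * u k + t * v k) N
      + t * (1 - t) * total_supply (\<lambda>k. 1 * u k + (-1) * v k) N
    = (1 - t) * total_supply u N + t * total_supply v N"
  unfolding total_supply_linear unfolding total_supply_def sum_distrib_left sum.distrib[symmetric]
  by (intro sum.cong refl) algebra

text \<open>Zero inputs prepended to a control leave the state at the origin and cost nothing, so
  any horizon can be lengthened.\<close>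

lemma reach_delay:
  obtains v where "reach v (N + d) = reach u N" "total_supply v (N + d) = total_supply u N"
proof (induction d arbitrary: thesis)
  case 0
  then show ?case by simp
next
  case (Suc d)
  obtain v where v: "reach v (N + d) = reach u N" "total_supply v (N + d) = total_supply u N"
    using Suc.IH by blast
  define w where "w = case_nat 0 v"
  have w: "reach w (Suc k) = reach v k" for k
    by (induction k) (simp_all add: w_def step_def linear_0[OF linear_A])
  have "total_supply w (Suc (N + d)) = total_supply v (N + d)"
    unfolding total_supply_def sum.lessThan_Suc_shift w
    by (simp add: w_def step_def linear_0[OF linear_A])
  with w v show ?case
    by (intro Suc.prems[of w]) (simp_all del: state_seq.simps)
qed

text \<open>Superposition combines controls of equal length only; both controls are padded to the
  sum of their horizons.\<close>

lemma supplies_common_horizon: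
  assumes "i \<in> supplies x" "j \<in> supplies y"
  obtains u v N where "reach u N = x" "total_supply u N = i" "reach v N = y" "total_supply v N = j"
proof -
  obtain u N v M where uv: "reach u N = x" "total_supply u N = i" "reach v M = y" "total_supply v M = j"
    using assms by (auto simp: supplies_def)
  obtain u' where "reach u' (N + M) = x" "total_supply u' (N + M) = i"
    using reach_delay[of N M u] uv by metis
  moreover obtain v' where "reach v' (N + M) = y" "total_supply v' (N + M) = j"
    using reach_delay[of M N v] uv by (metis add.commute)
  ultimately show ?thesis by (rule that)
qed

end

section \<open>The required supply as a storage function\<close>

locale dissipative_siso = linear_siso A b c
  for A :: "'x::euclidean_space \<Rightarrow> 'x" and b c :: 'x +
  fixes V :: "'x \<Rightarrow> real"
  assumes V_0: "V 0 = 0"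
    and V_pos: "x \<noteq> 0 \<Longrightarrow> V x > 0"
    and V_step: "V (step x u) - V x \<le> u * (c \<bullet> step x u - c \<bullet> x)"
    and reachable: "\<exists>u N. reach u N = x"
begin

lemma supplies_nonempty: "supplies x \<noteq> {}"
  using reachable[of x] by (auto simp: supplies_def)

text \<open>The dissipation inequality telescopes along a trajectory that starts where
  \<open>V\<close> vanishes.\<close>

lemma storage_le_supply: "V (reach u N) \<le> total_supply u N"
proof (induction N)
  case (Suc N)
  then show ?case using V_step[of "reach u N" "u N"] by (simp add: total_supply_def)
qed (simp add: total_supply_def V_0)

lemma storage_le_supplies: "j \<in> supplies x \<Longrightarrow> V x \<le> j"
  using storage_le_supply by (auto simp: supplies_def)

lemma storage_nonneg: "0 \<le> V x"
  using V_0 V_pos[of x] by (cases "x = 0") auto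

lemma total_supply_nonneg: "0 \<le> total_supply u N"
  using storage_le_supply storage_nonneg order_trans by blast

lemma required_supply_le: "j \<in> supplies x \<Longrightarrow> required_supply x \<le> j"
  unfolding required_supply_def
  by (intro cInf_lower bdd_belowI[of _ "V x"] storage_le_supplies)

lemma required_supply_le_supply: "reach u N = x \<Longrightarrow> required_supply x \<le> total_supply u N"
  by (intro required_supply_le) (auto simp: supplies_def)

lemma le_required_supply: "(\<And>j. j \<in> supplies x \<Longrightarrow> l \<le> j) \<Longrightarrow> l \<le> required_supply x"
  unfolding required_supply_def by (intro cInf_greatest supplies_nonempty)

text \<open>The two infima are taken one after the other: over \<open>j\<close> with
  \<open>i\<close> fixed, then over \<open>i\<close>.\<close>

lemma le_required_supply2:
  assumes "\<And>i j. i \<in> supplies x \<Longrightarrow> j \<in> supplies y \<Longrightarrow> l \<le> p * i + q * j" "p > 0" "q > 0"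
  shows "l \<le> p * required_supply x + q * required_supply y"
proof -
  have "(l - p * i) / q \<le> required_supply y" if "i \<in> supplies x" for i
    using assms(1)[OF that] assms(2,3) by (intro le_required_supply) (simp add: field_simps)
  then have "(l - q * required_supply y) / p \<le> required_supply x"
    using assms(2,3) by (intro le_required_supply) (simp add: field_simps)
  then show ?thesis using assms(2) by (simp add: field_simps)
qed

lemma required_supply_0: "required_supply 0 = 0"
proof (rule antisym)
  show "required_supply 0 \<le> 0"
    using required_supply_le_supply[of "\<lambda>_. 0" 0] by (simp add: total_supply_def)
  show "0 \<le> required_supply 0"
    using storage_le_supplies[of _ 0] V_0 by (intro le_required_supply) simp
qed

lemma required_supply_pos: "x \<noteq> 0 \<Longrightarrow> required_supply x > 0"
  using V_pos[of x] le_required_supply[of x "V x"] storage_le_supplies[of _ x] by force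

lemma required_supply_nonneg: "0 \<le> required_supply x"
  using required_supply_0 required_supply_pos[of x] by (cases "x = 0") auto

text \<open>A control reaching \<open>x\<close> at time \<open>N\<close>, followed by the input
  \<open>w\<close>, is a candidate for the next state and costs exactly one more supply
  term.\<close>

lemma required_supply_step:
  "required_supply (step x w) - required_supply x \<le> w * (c \<bullet> step x w - c \<bullet> x)"
proof -
  have "required_supply (step x w) - w * (c \<bullet> step x w - c \<bullet> x) \<le> required_supply x"
  proof (rule le_required_supply)
    fix j assume "j \<in> supplies x"
    then obtain u N where u: "j = total_supply u N" "reach u N = x" by (auto simp: supplies_def)
    have r: "reach (u(N := w)) N = x" using reach_cong[of N "u(N := w)" u] u by simp
    have "total_supply (u(N := w)) (Suc N) = j + w * (c \<bullet> step x w - c \<bullet> x)"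
      using total_supply_cong[of N "u(N := w)" u] u r by (simp add: total_supply_def)
    moreover have "reach (u(N := w)) (Suc N) = step x w" using r by simp
    ultimately show "required_supply (step x w) - w * (c \<bullet> step x w - c \<bullet> x) \<le> j"
      using required_supply_le_supply by fastforce
  qed
  then show ?thesis by simp
qed

text \<open>Scaling the controls gives one inequality; the same inequality for the factor 1/t gives
  the other.\<close>

lemma required_supply_scale: "required_supply (t *\<^sub>R x) = t\<^sup>2 * required_supply x"
proof (cases "t = 0")
  case True
  then show ?thesis by (simp add: required_supply_0)
next
  case False
  have *: "required_supply (s *\<^sub>R y) \<le> s\<^sup>2 * required_supply y" if "s \<noteq> 0" for s y
  proof -
    have "required_supply (s *\<^sub>R y) / s\<^sup>2 \<le> required_supply y"
    proof (rule le_required_supply)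
      fix j assume "j \<in> supplies y"
      then obtain u N where u: "j = total_supply u N" "reach u N = y" by (auto simp: supplies_def)
      have "reach (\<lambda>k. s * u k) N = s *\<^sub>R y" using reach_linear[of s u 0 u N] u by simp
      from required_supply_le_supply[OF this] show "required_supply (s *\<^sub>R y) / s\<^sup>2 \<le> j"
        using that u by (simp add: total_supply_scale field_simps)
    qed
    then show ?thesis using that by (simp add: field_simps)
  qed
  show ?thesis
    using *[of t x] *[of "inverse t" "t *\<^sub>R x"] False by (auto simp: field_simps intro: antisym)
qed

text \<open>Sums and differences of controls for \<open>x\<close> and \<open>y\<close> are
  candidates for \<open>x + y\<close> and \<open>x - y\<close>, which gives one inequality. Applied
  to \<open>x + y\<close> and \<open>x - y\<close> themselves it becomes, by homogeneity, the
  reverse one.\<close>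

lemma required_supply_parallelogram:
  "required_supply (x + y) + required_supply (x - y) = 2 * required_supply x + 2 * required_supply y"
proof -
  have *: "required_supply (x + y) + required_supply (x - y)
      \<le> 2 * required_supply x + 2 * required_supply y" for x y
  proof (rule le_required_supply2)
    fix i j assume "i \<in> supplies x" "j \<in> supplies y"
    then obtain u v N where uv: "reach u N = x" "total_supply u N = i" "reach v N = y" "total_supply v N = j"
      by (rule supplies_common_horizon)
    have "required_supply (x + y) \<le> total_supply (\<lambda>k. 1 * u k + 1 * v k) N"
      "required_supply (x - y) \<le> total_supply (\<lambda>k. 1 * u k + (-1) * v k) N"
      by (intro required_supply_le_supply; simp only: reach_linear uv; simp)+
    then show "required_supply (x + y) + required_supply (x - y) \<le> 2 * i + 2 * j"
      using total_supply_parallelogram[of u v N] uv by linarith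
  qed simp_all
  have "x + y + (x - y) = 2 *\<^sub>R x" "x + y - (x - y) = 2 *\<^sub>R y"
    by (simp_all add: scaleR_2)
  then show ?thesis
    using *[of x y] *[of "x + y" "x - y"] by (simp add: required_supply_scale)
qed

text \<open>The convexity defect of the supply is t(1 - t) times the supply of the difference
  control, which is nonnegative. Convexity serves to obtain continuity in finite dimension.\<close>

lemma required_supply_convex: "convex_on UNIV required_supply"
proof (rule convex_onI)
  fix t :: real and x y :: 'x
  assume t: "0 < t" "t < 1"
  show "required_supply ((1 - t) *\<^sub>R x + t *\<^sub>R y)
      \<le> (1 - t) * required_supply x + t * required_supply y"
  proof (rule le_required_supply2)
    fix i j assume "i \<in> supplies x" "j \<in> supplies y"
    then obtain u v N where uv: "reach u N = x" "total_supply u N = i" "reach v N = y" "total_supply v N = j"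
      by (rule supplies_common_horizon)
    have "required_supply ((1 - t) *\<^sub>R x + t *\<^sub>R y) \<le> total_supply (\<lambda>k. (1 - t) * u k + t * v k) N"
      by (intro required_supply_le_supply) (simp only: reach_linear uv)
    moreover have "0 \<le> t * (1 - t) * total_supply (\<lambda>k. 1 * u k + (-1) * v k) N"
      using t total_supply_nonneg by simp
    ultimately show "required_supply ((1 - t) *\<^sub>R x + t *\<^sub>R y) \<le> (1 - t) * i + t * j"
      using total_supply_convex_combination[of t u v N] unfolding uv by linarith
  qed (use t in simp_all)
qed simp

lemma required_supply_continuous: "continuous_on UNIV required_supply"
  by (rule convex_on_continuous[OF open_UNIV required_supply_convex])

section \<open>Polarization and expansion about a steady state\<close>

text \<open>\<open>D p\<close> is four times the polar form of the required supply with
  \<open>p\<close> fixed. As in the Jordan-von Neumann argument, the parallelogram law gives a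
  midpoint identity, and \<open>D p 0 = 0\<close> turns it into additivity.\<close>

lemma required_supply_polar_add:
  defines "D \<equiv> \<lambda>p d. required_supply (p + d) - required_supply (p - d)"
  shows "D p (d + e) = D p d + D p e"
proof -
  have half: "D p d + D p e = 2 * D p ((1/2) *\<^sub>R (d + e))" for d e
  proof -
    define m n where "m = (1/2) *\<^sub>R (d + e)" and "n = (1/2) *\<^sub>R (d - e)"
    have "m + n = (1/2 + 1/2) *\<^sub>R d" "m - n = (1/2 + 1/2) *\<^sub>R e"
      unfolding m_def n_def by (simp_all add: algebra_simps flip: scaleR_add_left)
    then have de: "d = m + n" "e = m - n" by simp_all
    show ?thesis
      using required_supply_parallelogram[of "p + m" n] required_supply_parallelogram[of "p - m" n]
      unfolding D_def de by (simp add: algebra_simps flip: scaleR_2)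
  qed
  have "D p 0 = 0" by (simp add: D_def)
  then show ?thesis using half[of d e] half[of "d + e" 0] by simp
qed

text \<open>In deviations from \<open>p\<close>, dissipation bounds the first-order term
  \<open>E\<close> on the range of A - I by a quadratic term. An additive functional so bounded
  vanishes; hence \<open>p\<close> is the critical point of S x - u (c \<bullet> x), and the square
  is completed there.\<close>

lemma required_supply_steady_state:
  assumes p: "step p u = p" and surj: "surj (\<lambda>x. A x - x)"
  shows "required_supply x - u * (c \<bullet> x) = required_supply (x - p) - u * (c \<bullet> p) / 2"
proof -
  define E where
    "E d = (required_supply (p + d) - required_supply (p - d)) / 2 - u * (c \<bullet> d)" for d
  have E_add: "E (d + e) = E d + E e" for d e
    using required_supply_polar_add[of p d e]
    by (simp add: E_def algebra_simps add_divide_distrib diff_divide_distrib)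
  have E_0: "E 0 = 0" by (simp add: E_def)
  have E_neg: "E (- d) = - E d" for d
    using E_add[of d "- d"] E_0 by simp
  have expand: "required_supply (p + d) - u * (c \<bullet> (p + d))
      = required_supply p - u * (c \<bullet> p) + required_supply d + E d" for d
    using required_supply_parallelogram[of p d] by (simp add: E_def algebra_simps diff_divide_distrib)
  have E_le: "E (A d - d) \<le> required_supply d" for d
  proof -
    have "step (p + d) u = p + A d"
      using p by (simp add: step_def linear_add[OF linear_A] algebra_simps)
    then have "required_supply (A d) + E (A d) \<le> required_supply d + E d"
      using required_supply_step[of "p + d" u] expand[of d] expand[of "A d"]
      by (simp add: algebra_simps)
    moreover have "E (A d) = E (A d - d) + E d" using E_add[of "A d - d" d] by simp
    ultimately show ?thesis using required_supply_nonneg[of "A d"] by linarith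
  qed
  have E_scale: "E (real n *\<^sub>R d) = real n * E d" for n d
    by (induction n) (simp_all add: E_0 E_add algebra_simps)
  have E_nonpos: "E d \<le> 0" for d
  proof -
    obtain r where r: "d = A r - r" using surj by auto
    \<comment> \<open>Replacing \<open>r\<close> by \<open>r / n\<close> divides the linear side by
      n but the quadratic side by n squared.\<close>
    have "real n * E d \<le> required_supply r" for n
    proof (cases "n = 0")
      case False
      define s where "s = (1 / real n) *\<^sub>R r"
      have "real n *\<^sub>R (A s - s) = d"
        using False by (simp add: s_def r linear_scale[OF linear_A] algebra_simps)
      then have "real n * E (A s - s) = E d" by (metis E_scale)
      moreover have "real n * E (A s - s) \<le> real n * required_supply s"
        using E_le by (simp add: mult_left_mono)
      ultimately have "E d \<le> required_supply r / real n"
        using False by (simp add: s_def required_supply_scale power2_eq_square)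
      then show ?thesis using False by (simp add: field_simps)
    qed (simp add: required_supply_nonneg)
    then show ?thesis
      by (meson not_le reals_Archimedean3)
  qed
  have E: "E d = 0" for d
    using E_nonpos[of d] E_nonpos[of "- d"] E_neg[of d] by simp
  \<comment> \<open>Expanding at the deviation \<open>d = p\<close> evaluates the required supply at
    \<open>p\<close> itself.\<close>
  have "required_supply (2 *\<^sub>R p) = 4 * required_supply p"
    by (simp add: required_supply_scale)
  then have "required_supply p = u * (c \<bullet> p) / 2"
    using expand[of p] E by (simp add: scaleR_2 inner_add_right algebra_simps)
  then show ?thesis
    using expand[of "x - p"] E by (simp add: algebra_simps)
qed

end

section \<open>Sector bound and dissipation of the HIGS\<close>

text \<open>The region is precisely the condition u e >= u^2 / \<kappa> on the integrator's new
  value u; the gain mode attains equality.\<close>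

lemma higs_sector:
  assumes "0 < \<kappa>"
  shows "\<bar>higs_step \<omega> \<kappa> x e\<bar> \<le> \<kappa> * \<bar>e\<bar>"
proof -
  let ?u = "higs_step \<omega> \<kappa> x e"
  have "?u * e \<ge> ?u\<^sup>2 / \<kappa>"
    using assms by (auto simp: higs_step_def higs_region_def power2_eq_square)
  then have *: "?u\<^sup>2 \<le> \<kappa> * (?u * e)" using assms by (simp add: field_simps)
  have "\<bar>?u\<bar> * \<bar>?u\<bar> \<le> \<bar>?u\<bar> * (\<kappa> * \<bar>e\<bar>)"
    using order_trans[OF * abs_ge_self] assms
    by (simp add: power2_eq_square abs_mult mult_ac)
  then show ?thesis
    using assms mult_le_cancel_left_pos[of "\<bar>?u\<bar>" "\<bar>?u\<bar>" "\<kappa> * \<bar>e\<bar>"]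
    by (cases "?u = 0") simp_all
qed

lemma higs_dissipation:
  fixes \<omega> \<kappa> x e :: real
  assumes "0 < \<omega>" "0 < \<kappa>"
  defines "u \<equiv> higs_step \<omega> \<kappa> x e"
  shows "- e * (u - x) + u\<^sup>2 / (2 * \<kappa>) - x\<^sup>2 / (2 * \<kappa>) \<le> - (u - x)\<^sup>2 / (2 * \<kappa>)"
proof -
  \<comment> \<open>After multiplication by 2 \<kappa> the claim factors into this product. The
    second factor vanishes in gain mode; in integrator mode the first is \<omega> e and the sector
    bound gives the sign.\<close>
  have "(u - x) * (\<kappa> * e - u) \<ge> 0"
  proof (cases "(x, e) \<in> higs_region \<omega> \<kappa>")
    case True
    then have "u - x = \<omega> * e" by (simp add: u_def higs_step_def)
    moreover have "e * (\<kappa> * e - u) \<ge> 0"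
    proof (cases "e \<ge> 0")
      case True
      then have "\<kappa> * e - u \<ge> 0"
        using higs_sector[OF assms(2), of \<omega> x e] unfolding u_def by simp
      with True show ?thesis by simp
    next
      case False
      then have "\<kappa> * e - u \<le> 0"
        using higs_sector[OF assms(2), of \<omega> x e] unfolding u_def by simp
      with False show ?thesis by (simp add: zero_le_mult_iff)
    qed
    ultimately show ?thesis using assms(1) by (simp add: mult.assoc)
  next
    case False
    then show ?thesis by (simp add: u_def higs_step_def)
  qed
  then show ?thesis
    using assms(2) by (simp add: divide_simps power2_eq_square) (simp add: algebra_simps)
qed

text \<open>In the integrator mode both terms of the difference are of the order of the increment;
  in the gain mode the difference vanishes.\<close>

lemma higs_gain_error:
  fixes \<omega> \<kappa> x e :: real
  assumes "0 < \<omega>" "0 < \<kappa>"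
  defines "u \<equiv> higs_step \<omega> \<kappa> x e"
  shows "\<bar>u - \<kappa> * e\<bar> \<le> 2 * \<kappa> / \<omega> * \<bar>u - x\<bar>"
proof (cases "(x, e) \<in> higs_region \<omega> \<kappa>")
  case True
  then have "\<bar>u - x\<bar> = \<omega> * \<bar>e\<bar>" using assms(1) by (simp add: u_def higs_step_def abs_mult)
  moreover have "\<bar>u - \<kappa> * e\<bar> \<le> \<bar>u\<bar> + \<kappa> * \<bar>e\<bar>"
    using assms(2) by (metis abs_mult abs_of_pos abs_triangle_ineq4)
  ultimately show ?thesis using higs_sector[OF assms(2), of \<omega> x e] assms(1) by (simp add: u_def)
next
  case False
  then show ?thesis using assms by (simp add: u_def higs_step_def)
qed

section \<open>Convergence from observability and the steady-state gain\<close>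

text \<open>By observability the functionals \<open>c \<bullet> A\<^sup>i z\<close> span the dual space.\<close>

lemma observable_tendsto_zero:
  fixes A :: "'x::euclidean_space \<Rightarrow> 'x"
  assumes A: "linear A" and obs: "\<And>z. (\<And>i. c \<bullet> (A ^^ i) z = 0) \<Longrightarrow> z = 0"
    and lim: "\<And>i. (\<lambda>k. c \<bullet> (A ^^ i) (z k)) \<longlonglongrightarrow> 0"
  shows "z \<longlonglongrightarrow> 0"
proof -
  define f where "f i = (adjoint A ^^ i) c" for i
  have f: "f i \<bullet> x = c \<bullet> (A ^^ i) x" for i x
  proof (induction i arbitrary: x)
    case (Suc i)
    then show ?case
      using adjoint_works[OF A, of x "f i"] by (simp add: f_def funpow_swap1 inner_commute)
  qed (simp add: f_def)
  have "span (range f) = UNIV"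
  proof (rule ccontr)
    assume "span (range f) \<noteq> UNIV"
    then obtain a where "a \<noteq> 0" and a: "\<forall>x\<in>span (range f). a \<bullet> x = 0"
      using span_not_UNIV_orthogonal by metis
    moreover have "c \<bullet> (A ^^ i) a = 0" for i
      using bspec[OF a span_base[of "f i" "range f"]] f[of i a] by (simp add: inner_commute)
    ultimately show False using obs by blast
  qed
  moreover have "(\<lambda>k. w \<bullet> z k) \<longlonglongrightarrow> 0" if "w \<in> span (range f)" for w
    using that
  proof (induction rule: span_induct_alt)
    case base
    then show ?case by simp
  next
    case (step r x y)
    then obtain i where "x = f i" by auto
    then have "(\<lambda>k. r * (x \<bullet> z k) + y \<bullet> z k) \<longlonglongrightarrow> r * 0 + 0"
      using lim[of i] step by (intro tendsto_intros) (simp_all add: f)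
    then show ?case by (simp add: inner_add_left)
  qed
  ultimately show ?thesis
    by (subst tendsto_componentwise_iff) (simp add: inner_commute)
qed

lemma (in linear_siso) asymptotic_gain_tendsto_zero:
  fixes x :: "nat \<Rightarrow> 'x" and u :: "nat \<Rightarrow> real"
  assumes obs: "\<And>z. (\<And>i. c \<bullet> (A ^^ i) z = 0) \<Longrightarrow> z = 0"
    and inj: "inj (\<lambda>x. A x - x)"
    and p: "step p 1 = p"
    and gain: "\<kappa> * (c \<bullet> p) \<noteq> 1"
    and x: "\<And>k. x (Suc k) = step (x k) (u (Suc k))"
    and du: "(\<lambda>k. u (Suc k) - u k) \<longlonglongrightarrow> 0"
    and sector: "(\<lambda>k. u (Suc k) - \<kappa> * (c \<bullet> x k)) \<longlonglongrightarrow> 0" and \<kappa>: "\<kappa> \<noteq> 0"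
  shows "x \<longlonglongrightarrow> 0" "u \<longlonglongrightarrow> 0"
proof -
  note lin = linear_add[OF linear_A] linear_diff[OF linear_A] linear_scale[OF linear_A]
  define z where "z k = x (Suc k) - x k" for k
  have z_Suc: "z (Suc k) = A (z k) + (u (Suc (Suc k)) - u (Suc k)) *\<^sub>R b" for k
    by (simp add: z_def x step_def lin algebra_simps)
  have du': "(\<lambda>k. u (Suc (Suc k)) - u (Suc k)) \<longlonglongrightarrow> 0"
    using LIMSEQ_Suc[OF du] .
  have "(\<lambda>k. c \<bullet> (A ^^ i) (z k)) \<longlonglongrightarrow> 0" for i
  proof (induction i)
    case 0
    \<comment> \<open>Each output is the next input divided by \<kappa>, up to a vanishing sector
      error, so output increments inherit the decay of the input increments.\<close>
    have "(\<lambda>k. (1 / \<kappa>) * ((u (Suc (Suc k)) - u (Suc k))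
        - (u (Suc (Suc k)) - \<kappa> * (c \<bullet> x (Suc k))) + (u (Suc k) - \<kappa> * (c \<bullet> x k))))
        \<longlonglongrightarrow> (1 / \<kappa>) * (0 - 0 + 0)"
      using du' sector LIMSEQ_Suc[OF sector] by (intro tendsto_intros)
    moreover have "(1 / \<kappa>) * ((u (Suc (Suc k)) - u (Suc k))
        - (u (Suc (Suc k)) - \<kappa> * (c \<bullet> x (Suc k))) + (u (Suc k) - \<kappa> * (c \<bullet> x k)))
        = c \<bullet> (A ^^ 0) (z k)" for k
      using \<kappa> by (simp add: z_def inner_diff_right field_simps)
    ultimately show ?case by simp
  next
    case (Suc i)
    have lin_i: "linear (A ^^ i)"
      by (induction i) (use linear_compose[OF _ linear_A] linear_id in \<open>simp_all add: id_def o_def\<close>)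
    \<comment> \<open>One more power of \<open>A\<close> is traded for a time shift and a vanishing
      input term.\<close>
    have "(A ^^ Suc i) (z k)
        = (A ^^ i) (z (Suc k)) - (u (Suc (Suc k)) - u (Suc k)) *\<^sub>R (A ^^ i) b" for k
      by (simp add: z_Suc funpow_swap1 linear_add[OF lin_i] linear_scale[OF lin_i])
    then have "(\<lambda>k. c \<bullet> (A ^^ Suc i) (z k)) = (\<lambda>k. c \<bullet> (A ^^ i) (z (Suc k))
        - (u (Suc (Suc k)) - u (Suc k)) * (c \<bullet> (A ^^ i) b))"
      by (simp add: inner_diff_right del: funpow.simps)
    moreover have "\<dots> \<longlonglongrightarrow> 0 - 0 * (c \<bullet> (A ^^ i) b)"
      using LIMSEQ_Suc[OF Suc] du' by (intro tendsto_intros)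
    ultimately show ?case by simp
  qed
  then have z: "z \<longlonglongrightarrow> 0"
    using observable_tendsto_zero[OF linear_A obs] by blast
  have linI: "linear (\<lambda>x. A x - x)"
    using linear_compose_sub[OF linear_A linear_id] by (simp add: id_def)
  then obtain R where R: "linear R" "\<And>x. R (A x - x) = x"
    using linear_injective_left_inverse[OF linI inj] by (metis comp_apply id_apply)
  \<comment> \<open>The state is compared with the steady state of the current input; A - I maps
    this deviation to the increment \<open>z k\<close>.\<close>
  have "x k - u (Suc k) *\<^sub>R p = R (z k)" for k
  proof -
    have "z k = A (x k - u (Suc k) *\<^sub>R p) - (x k - u (Suc k) *\<^sub>R p)"
    proof -
      have "b = p - A p" using p by (simp add: step_def algebra_simps)
      then have "u (Suc k) *\<^sub>R b = u (Suc k) *\<^sub>R p - A (u (Suc k) *\<^sub>R p)"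
        by (simp only: lin scaleR_diff_right)
      then show ?thesis by (simp add: z_def x step_def lin(2))
    qed
    then show ?thesis using R(2) by simp
  qed
  moreover have Rz: "(\<lambda>k. R (z k)) \<longlonglongrightarrow> 0"
    using linear_continuous_at[of R 0] R(1) z linear_0[OF R(1)]
      isCont_tendsto_compose[of 0 R z]
    by (simp add: linear_conv_bounded_linear)
  ultimately have dev: "(\<lambda>k. x k - u (Suc k) *\<^sub>R p) \<longlonglongrightarrow> 0" by simp
  \<comment> \<open>The two vanishing errors add up to (1 - \<kappa> (c \<bullet> p)) u, and the
    gain condition permits division.\<close>
  have "(\<lambda>k. ((u (Suc k) - \<kappa> * (c \<bullet> x k)) + \<kappa> * (c \<bullet> (x k - u (Suc k) *\<^sub>R p)))
      / (1 - \<kappa> * (c \<bullet> p))) \<longlonglongrightarrow> (0 + \<kappa> * (c \<bullet> 0)) / (1 - \<kappa> * (c \<bullet> p))"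
    using sector dev gain by (intro tendsto_intros) auto
  moreover have "((u (Suc k) - \<kappa> * (c \<bullet> x k)) + \<kappa> * (c \<bullet> (x k - u (Suc k) *\<^sub>R p)))
      / (1 - \<kappa> * (c \<bullet> p)) = u (Suc k)" for k
    using gain by (simp add: inner_diff_right field_simps)
  ultimately have u: "(\<lambda>k. u (Suc k)) \<longlonglongrightarrow> 0" by simp
  then show "u \<longlonglongrightarrow> 0" by (rule LIMSEQ_imp_Suc)
  have "(\<lambda>k. (x k - u (Suc k) *\<^sub>R p) + u (Suc k) *\<^sub>R p) \<longlonglongrightarrow> 0 + 0 *\<^sub>R p"
    using dev u by (intro tendsto_intros)
  then show "x \<longlonglongrightarrow> 0" by simp
qed

section \<open>Quadratic bounds and Lyapunov stability\<close>

text \<open>The constants are the extrema of \<open>W\<close> on the compact unit sphere, carried to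
  all vectors by homogeneity.\<close>

lemma positive_homogeneous_bounds:
  fixes W :: "'z::euclidean_space \<Rightarrow> real"
  assumes cont: "continuous_on UNIV W" and pos: "\<And>z. z \<noteq> 0 \<Longrightarrow> W z > 0"
    and scale: "\<And>t z. W (t *\<^sub>R z) = t\<^sup>2 * W z"
  obtains l r where "0 < l" "0 < r" "\<And>z. l * (norm z)\<^sup>2 \<le> W z" "\<And>z. W z \<le> r * (norm z)\<^sup>2"
proof -
  have ne: "sphere 0 1 \<noteq> ({} :: 'z set)" by simp
  have cs: "continuous_on (sphere 0 1) W" using cont continuous_on_subset by blast
  obtain a where a: "a \<in> sphere 0 1" "\<And>z. z \<in> sphere 0 1 \<Longrightarrow> W a \<le> W z"
    using continuous_attains_inf[OF compact_sphere ne cs] by blast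
  obtain d where d: "d \<in> sphere 0 1" "\<And>z. z \<in> sphere 0 1 \<Longrightarrow> W z \<le> W d"
    using continuous_attains_sup[OF compact_sphere ne cs] by blast
  have W: "W z = W ((1 / norm z) *\<^sub>R z) * (norm z)\<^sup>2" for z
    using scale[of 0 0] by (cases "z = 0") (simp_all add: scale field_simps)
  have s: "(1 / norm z) *\<^sub>R z \<in> sphere 0 1" if "z \<noteq> 0" for z :: 'z using that by simp
  show ?thesis
  proof (rule that[of "W a" "W d"])
    show "0 < W a" "0 < W d" using a d by (auto intro!: pos)
    show "W a * (norm z)\<^sup>2 \<le> W z" for z
      using W[of z] a(2)[OF s[of z]] by (cases "z = 0") (auto intro: mult_right_mono)
    show "W z \<le> W d * (norm z)\<^sup>2" for z
      using W[of z] d(2)[OF s[of z]] by (cases "z = 0") (auto intro: mult_right_mono)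
  qed
qed

lemma lyapunov_stable_quadratic_bounds:
  fixes F :: "'z::real_normed_vector \<Rightarrow> 'z"
  assumes l: "0 < l" and r: "0 < r"
    and lower: "\<And>z. l * (norm z)\<^sup>2 \<le> W z" and upper: "\<And>z. W z \<le> r * (norm z)\<^sup>2"
    and decr: "\<And>z. W (F z) \<le> W z"
  shows "lyapunov_stable F 0"
  unfolding lyapunov_stable_def
proof (intro allI impI)
  fix \<epsilon> :: real assume \<epsilon>: "\<epsilon> > 0"
  have mono: "W ((F ^^ k) z) \<le> W z" for k z
    by (induction k) (auto intro: order_trans[OF decr])
  \<comment> \<open>The radius solves r \<delta>^2 = l \<epsilon>^2.\<close>
  show "\<exists>\<delta>>0. \<forall>z. dist z 0 < \<delta> \<longrightarrow> (\<forall>k. dist ((F ^^ k) z) 0 < \<epsilon>)"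
  proof (intro exI[of _ "sqrt (l / r) * \<epsilon>"] conjI allI impI)
    show "sqrt (l / r) * \<epsilon> > 0" using l r \<epsilon> by simp
    fix z :: 'z and k assume "dist z 0 < sqrt (l / r) * \<epsilon>"
    then have "(norm z)\<^sup>2 < (sqrt (l / r) * \<epsilon>)\<^sup>2" by (intro power_strict_mono) auto
    then have "r * (norm z)\<^sup>2 < l * \<epsilon>\<^sup>2"
      using l r by (simp add: power_mult_distrib field_simps)
    then have "l * (norm ((F ^^ k) z))\<^sup>2 < l * \<epsilon>\<^sup>2"
      using lower[of "(F ^^ k) z"] mono[of k z] upper[of z] by linarith
    then show "dist ((F ^^ k) z) 0 < \<epsilon>"
      using l \<epsilon> by (simp add: power_less_imp_less_base)
  qed
qed

section \<open>Asymptotic stability of the closed loop\<close>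

lemma (in dissipative_siso) higs_loop_asymptotically_stable:
  assumes obs: "\<And>z. (\<And>i. c \<bullet> (A ^^ i) z = 0) \<Longrightarrow> z = 0"
    and bij: "bij (\<lambda>x. A x - x)"
    and p: "step p 1 = p"
    and \<omega>: "0 < \<omega>" and \<kappa>: "0 < \<kappa>" and gain: "\<kappa> * (c \<bullet> p) < 1"
  defines "F \<equiv> \<lambda>(x, v). (step x (higs_step \<omega> \<kappa> v (c \<bullet> x)), higs_step \<omega> \<kappa> v (c \<bullet> x))"
  shows "asymptotically_stable F (0, 0)"
proof -
  define W where "W z = required_supply (fst z) - snd z * (c \<bullet> fst z) + (snd z)\<^sup>2 / (2 * \<kappa>)"
    for z :: "'x \<times> real"
  have steady: "step (v *\<^sub>R p) v = v *\<^sub>R p" for v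
  proof -
    have "step (v *\<^sub>R p) v = v *\<^sub>R step p 1"
      by (simp add: step_def linear_scale[OF linear_A] algebra_simps)
    then show ?thesis using p by simp
  qed
  \<comment> \<open>The square is completed at \<open>v *\<^sub>R p\<close>, the steady state for
    the constant input \<open>v\<close>; the gain condition makes the remaining coefficient
    positive.\<close>
  have W_eq: "W (x, v) = required_supply (x - v *\<^sub>R p) + v\<^sup>2 * (1 - \<kappa> * (c \<bullet> p)) / (2 * \<kappa>)" for x v
  proof -
    have "v\<^sup>2 * (1 - \<kappa> * (c \<bullet> p)) / (2 * \<kappa>) = v\<^sup>2 / (2 * \<kappa>) - v * (c \<bullet> v *\<^sub>R p) / 2"
      using \<kappa> by (simp add: field_simps power2_eq_square)
    then show ?thesis
      using required_supply_steady_state[OF steady bij_is_surj[OF bij], of x v]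
      by (simp add: W_def)
  qed
  have W_pos: "W z > 0" if "z \<noteq> 0" for z
  proof (cases z)
    case (Pair x v)
    show ?thesis
    proof (cases "v = 0")
      case True
      then show ?thesis using that Pair required_supply_pos[of x] by (simp add: W_eq zero_prod_def)
    next
      case False
      then have "v\<^sup>2 * (1 - \<kappa> * (c \<bullet> p)) / (2 * \<kappa>) > 0" using gain \<kappa> by simp
      then show ?thesis using Pair required_supply_nonneg[of "x - v *\<^sub>R p"] by (simp add: W_eq)
    qed
  qed
  have W_scale: "W (t *\<^sub>R z) = t\<^sup>2 * W z" for t z
    by (simp add: W_def required_supply_scale power_mult_distrib algebra_simps power2_eq_square)
  have "continuous_on UNIV (required_supply \<circ> (fst :: 'x \<times> real \<Rightarrow> 'x))"
    by (intro continuous_on_compose continuous_on_subset[OF required_supply_continuous]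
        continuous_intros) auto
  then have W_cont: "continuous_on UNIV W"
    unfolding W_def using \<kappa> by (intro continuous_intros) (auto simp: o_def)
  \<comment> \<open>With u the new HIGS state, the products of u with the new output cancel. What
    remains is -(u - v) (c \<bullet> x) plus the change of v^2 / (2 \<kappa>), as in
    \<open>higs_dissipation\<close>.\<close>
  have W_step: "W (F z) \<le> W z - (snd (F z) - snd z)\<^sup>2 / (2 * \<kappa>)" for z
  proof (cases z)
    case (Pair x v)
    show ?thesis
      using required_supply_step[of x "higs_step \<omega> \<kappa> v (c \<bullet> x)"]
        higs_dissipation[OF \<omega> \<kappa>, where x = v and e = "c \<bullet> x"]
      by (simp add: Pair F_def W_def algebra_simps)
  qed
  have W_decr: "W (F z) \<le> W z" for z
    by (rule order_trans[OF W_step]) (use \<kappa> in simp)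
  obtain l r where lr: "0 < l" "0 < r" "\<And>z. l * (norm z)\<^sup>2 \<le> W z" "\<And>z. W z \<le> r * (norm z)\<^sup>2"
    using positive_homogeneous_bounds[OF W_cont W_pos W_scale] by metis
  have "lyapunov_stable F 0"
    using lyapunov_stable_quadratic_bounds[OF lr W_decr] .
  moreover have "(\<lambda>k. (F ^^ k) z) \<longlonglongrightarrow> 0" for z
  proof -
    define x u where "x k = fst ((F ^^ k) z)" and "u k = snd ((F ^^ k) z)" for k
    have u_Suc: "u (Suc k) = higs_step \<omega> \<kappa> (u k) (c \<bullet> x k)" for k
      by (simp add: x_def u_def F_def case_prod_beta)
    have x_Suc: "x (Suc k) = step (x k) (u (Suc k))" for k
      by (simp add: x_def u_def F_def case_prod_beta)
    define w where "w k = W ((F ^^ k) z)" for k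
    have w_nonneg: "0 \<le> w k" for k
      using lr(3)[of "(F ^^ k) z"] lr(1) by (auto simp: w_def intro: order_trans[rotated])
    have w_Suc: "(u (Suc k) - u k)\<^sup>2 \<le> 2 * \<kappa> * (w k - w (Suc k))" for k
      using W_step[of "(F ^^ k) z"] \<kappa> by (simp add: w_def u_def field_simps)
    have "decseq w" unfolding w_def by (intro decseq_SucI) (simp add: W_decr)
    then obtain L where L: "w \<longlonglongrightarrow> L"
      using w_nonneg decseq_convergent[of w 0] by blast
    have "(\<lambda>k. 2 * \<kappa> * (w k - w (Suc k))) \<longlonglongrightarrow> 2 * \<kappa> * (L - L)"
      using L LIMSEQ_Suc[OF L] by (intro tendsto_intros)
    then have "(\<lambda>k. 2 * \<kappa> * (w k - w (Suc k))) \<longlonglongrightarrow> 0" by simp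
    then have "(\<lambda>k. (u (Suc k) - u k)\<^sup>2) \<longlonglongrightarrow> 0"
      by (rule Lim_null_comparison[rotated]) (simp add: w_Suc)
    then have du: "(\<lambda>k. u (Suc k) - u k) \<longlonglongrightarrow> 0" by simp
    have "(\<lambda>k. 2 * \<kappa> / \<omega> * \<bar>u (Suc k) - u k\<bar>) \<longlonglongrightarrow> 2 * \<kappa> / \<omega> * \<bar>0\<bar>"
      using du by (intro tendsto_intros)
    then have "(\<lambda>k. 2 * \<kappa> / \<omega> * \<bar>u (Suc k) - u k\<bar>) \<longlonglongrightarrow> 0" by simp
    then have "(\<lambda>k. u (Suc k) - \<kappa> * (c \<bullet> x k)) \<longlonglongrightarrow> 0"
      by (rule Lim_null_comparison[rotated])
        (use higs_gain_error[OF \<omega> \<kappa>] in \<open>simp add: u_Suc\<close>)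
    moreover have "\<kappa> * (c \<bullet> p) \<noteq> 1" "\<kappa> \<noteq> 0" using gain \<kappa> by auto
    ultimately have "x \<longlonglongrightarrow> 0" "u \<longlonglongrightarrow> 0"
      using asymptotic_gain_tendsto_zero[OF obs bij_is_inj[OF bij] p _ x_Suc du] by blast+
    then have "(\<lambda>k. (x k, u k)) \<longlonglongrightarrow> (0, 0)" by (rule tendsto_Pair)
    then show ?thesis by (simp add: x_def u_def zero_prod_def)
  qed
  moreover have "F 0 = 0"
    by (simp add: F_def zero_prod_def step_def higs_step_def linear_0[OF linear_A])
  ultimately show ?thesis by (simp add: asymptotically_stable_def zero_prod_def)
qed

section \<open>Transfer to the matrix formulation\<close>

theorem theorem2:
  fixes A :: "real^'n^'n" and B :: "real^1^'n" and C :: "real^'n^1"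
    and \<omega>\<^sub>h k\<^sub>h :: real
  assumes "minimal_realization A B C"
    and "det (mat 1 - A) \<noteq> 0"
    and "negative_imaginary (lin_step A B) (lin_output C)"
    and "0 < \<omega>\<^sub>h" and "\<omega>\<^sub>h \<le> k\<^sub>h"
    and "k\<^sub>h < 1 / (transfer_function A B C 1 $ 1 $ 1)"
  shows "asymptotically_stable
    (higs_closed_loop (lin_step A B) (lin_output C) \<omega>\<^sub>h k\<^sub>h) (0, 0)"
proof -
  let ?b = "column 1 B" and ?c = "C $ 1"
  interpret linear_siso "(*v) A" ?b ?c
    by (rule linear_siso.intro) (rule matrix_vector_mul_linear)
  have step: "lin_step A B x u = step x (u $ 1)" for x u
    unfolding lin_step_def step_def
    by (simp add: vec_eq_iff matrix_vector_mult_def column_def mult.commute)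
  have out: "lin_output C x $ 1 = ?c \<bullet> x" for x
    by (simp add: lin_output_def matrix_vector_mul_component)
  have seq: "state_seq (lin_step A B) 0 u N = reach (\<lambda>k. u k $ 1) N" for u N
    by (induction N) (simp_all add: step)
  obtain V where V: "positive_definite V"
    "\<And>x u. V (lin_step A B x u) - V x \<le> u \<bullet> (lin_output C (lin_step A B x u) - lin_output C x)"
    using assms(3) by (auto simp: negative_imaginary_def)
  have "V (step x w) - V x \<le> w * (?c \<bullet> step x w - ?c \<bullet> x)" for x w
    using V(2)[of x "vec w"] by (simp add: step out inner_vec_def)
  moreover have "\<exists>u N. reach u N = x" for x
    using assms(1) unfolding minimal_realization_def controllable_def seq[symmetric]
    by (metis seq)
  ultimately interpret dissipative_siso "(*v) A" ?b ?c V
    using V(1) by unfold_locales (auto simp: positive_definite_def)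
  define R where "R = matrix_inv (mat 1 - A)"
  \<comment> \<open>\<open>matrix_inv\<close> is a Hilbert choice; the determinant condition yields
    a witness for it.\<close>
  have inv: "(mat 1 - A) ** R = mat 1" "R ** (mat 1 - A) = mat 1"
    using assms(2) someI_ex[of "\<lambda>R. (mat 1 - A) ** R = mat 1 \<and> R ** (mat 1 - A) = mat 1"]
    unfolding R_def matrix_inv_def invertible_det_nz[symmetric] invertible_def by blast+
  have R: "(R *v x) - A *v (R *v x) = x" "R *v (x - A *v x) = x" for x
    using arg_cong[OF inv(1), of "\<lambda>M. M *v x"] arg_cong[OF inv(2), of "\<lambda>M. M *v x"]
    by (simp_all add: matrix_vector_mult_diff_rdistrib flip: matrix_vector_mul_assoc)
  have bij: "bij (\<lambda>x. A *v x - x)"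
  proof (rule o_bij)
    show "(\<lambda>x. - (R *v x)) \<circ> (\<lambda>x. A *v x - x) = id"
      using R(2) by (auto simp: fun_eq_iff matrix_vector_mult_diff_distrib)
    show "(\<lambda>x. A *v x - x) \<circ> (\<lambda>x. - (R *v x)) = id"
      using R(1) by (auto simp: fun_eq_iff linear_neg[OF linear_A])
  qed
  \<comment> \<open>The steady state for unit input; its output is G(1).\<close>
  have p: "step (R *v ?b) 1 = R *v ?b"
    using R(1)[of ?b] by (simp add: step_def algebra_simps)
  have "transfer_function A B C 1 $ 1 $ 1 = ?c \<bullet> (R *v ?b)"
    unfolding transfer_function_def R_def[symmetric] matrix_mul_assoc[symmetric]
    by (simp add: matrix_matrix_mult_def matrix_vector_mult_def column_def inner_vec_def)
  then have G: "k\<^sub>h < 1 / (?c \<bullet> (R *v ?b))" using assms(6) by simp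
  have k: "0 < k\<^sub>h" using assms(4,5) by simp
  \<comment> \<open>A positive number below 1 / G(1) forces G(1) > 0; the value G(1) = 0 is excluded
    too, as 1 / 0 = 0.\<close>
  then have "0 < ?c \<bullet> (R *v ?b)" using G by (metis less_trans zero_less_divide_1_iff)
  then have gain: "k\<^sub>h * (?c \<bullet> (R *v ?b)) < 1" using G by (simp add: field_simps)
  have obs: "z = 0" if "\<And>i. ?c \<bullet> (((*v) A ^^ i) z) = 0" for z
  proof -
    have zero: "((*v) A ^^ k) 0 = 0" for k by (induction k) simp_all
    have "lin_output C (((*v) A ^^ k) z) = lin_output C (((*v) A ^^ k) 0)" for k
      unfolding zero using that by (simp add: vec_eq_iff[where 'b = 1] out)
    then show ?thesis
      using assms(1) unfolding minimal_realization_def observable_def by blast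
  qed
  have "higs_closed_loop (lin_step A B) (lin_output C) \<omega>\<^sub>h k\<^sub>h
      = (\<lambda>(x, v). (step x (higs_step \<omega>\<^sub>h k\<^sub>h v (?c \<bullet> x)), higs_step \<omega>\<^sub>h k\<^sub>h v (?c \<bullet> x)))"
    by (simp add: higs_closed_loop_def higs_output_def step out Let_def)
  then show ?thesis
    using higs_loop_asymptotically_stable[OF obs bij p assms(4) k gain] by simp
qed

end
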